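(* Let $a,b,c$ be integers and $r,s,t$ real numbers, let $(V_n)_{n\ge 0}$ be the associated generalized Tribonacci sequence, and let $\varphi_n$ be the $n$th generalized Tribonacci hyperbolic spinor. Then for all integers $m>0$ the following hold, each whenever its denominator is nonzero: $$\sum_{n=0}^{m}\varphi_n=\frac{\varphi_{m+3}+(1-r)\varphi_{m+2}+(1-r-s)\varphi_{m+1}-\varphi_2+(r-1)\varphi_1+(r+s-1)\varphi_0}{r+s+t-1},$$ $$\sum_{n=0}^{m}\varphi_{2n}=\frac{(1-s)\varphi_{2m+2}+(t+rs)\varphi_{2m+1}+(t^2+rt)\varphi_{2m}+(s-1)\varphi_2+(-t-rs)\varphi_1+(r^2-s^2+rt+2s-1)\varphi_0}{(r+s+t-1)(r-s+t+1)},$$ $$\sum_{n=0}^{m}\varphi_{2n+1}=\frac{(r+t)\varphi_{2m+2}+(s-s^2+t^2+rt)\varphi_{2m+1}+(t-st)\varphi_{2m}+(-r-t)\varphi_2+(-1+s+r^2+rt)\varphi_1+(-t+st)\varphi_0}{(r-s+t+1)(r+s+t-1)}.$$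
   Context: Hyperbolic numbers are the elements $x+yj$ with $x,y\in\mathbb{R}$ and $j^2=1$ (a commutative ring). A hyperbolic spinor is a column vector with two hyperbolic number components; addition and scalar multiplication are componentwise. Given integers $a,b,c$ and real numbers $r,s,t$, the generalized Tribonacci sequence $(V_n)_{n\ge0}$ is defined by $V_0=a$, $V_1=b$, $V_2=c$ and $V_n=rV_{n-1}+sV_{n-2}+tV_{n-3}$ for $n\ge 3$. The $n$th generalized Tribonacci hyperbolic spinor is $\varphi_n=\begin{bmatrix} V_n+V_{n+3}j\\ -V_{n+1}+V_{n+2}j\end{bmatrix}$, $n\ge 0$. *)

theory Defs
  imports "HOL-Analysis.Analysis"
begin

section \<open>Hyperbolic numbers\<close>

text \<open>\<open>Hyp x y\<close> represents \<open>x + y j\<close> with \<open>j\<^sup>2 = 1\<close>; see \<open>Hyp_eq\<close> and \<open>hyp_j_squared\<close> below.\<close>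

datatype hyp = Hyp (hre: real) (him: real)

lemma hyp_eq_iff: "z = w \<longleftrightarrow> hre z = hre w \<and> him z = him w"
  by (cases z; cases w) simp

instantiation hyp :: "{comm_ring_1, real_algebra_1}"
begin

definition zero_hyp :: hyp where "0 = Hyp 0 0"

definition one_hyp :: hyp where "1 = Hyp 1 0"

definition plus_hyp :: "hyp \<Rightarrow> hyp \<Rightarrow> hyp"
  where "z + w = Hyp (hre z + hre w) (him z + him w)"

definition minus_hyp :: "hyp \<Rightarrow> hyp \<Rightarrow> hyp"
  where "z - w = Hyp (hre z - hre w) (him z - him w)"

definition uminus_hyp :: "hyp \<Rightarrow> hyp"
  where "- z = Hyp (- hre z) (- him z)"

definition times_hyp :: "hyp \<Rightarrow> hyp \<Rightarrow> hyp"
  where "z * w = Hyp (hre z * hre w + him z * him w) (hre z * him w + him z * hre w)"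

definition scaleR_hyp :: "real \<Rightarrow> hyp \<Rightarrow> hyp"
  where "c *\<^sub>R z = Hyp (c * hre z) (c * him z)"

instance
  by standard
    (simp_all add: hyp_eq_iff zero_hyp_def one_hyp_def plus_hyp_def minus_hyp_def
      uminus_hyp_def times_hyp_def scaleR_hyp_def algebra_simps)

end

definition hyp_j :: hyp where "hyp_j = Hyp 0 1"

lemma hyp_j_squared: "hyp_j\<^sup>2 = 1"
  by (simp add: power2_eq_square hyp_j_def times_hyp_def one_hyp_def)

lemma Hyp_eq: "Hyp x y = of_real x + of_real y * hyp_j"
  by (simp add: of_real_def hyp_j_def times_hyp_def plus_hyp_def scaleR_hyp_def one_hyp_def)


section \<open>Hyperbolic spinors\<close>

text \<open>Addition of spinors is the library addition on \<open>hyp ^ 2\<close>. A hyperbolic scalar acts by \<open>*s\<close>;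
  for a real scalar this agrees with \<open>*\<^sub>R\<close>.\<close>

type_synonym hyp_spinor = "hyp ^ 2"

lemma of_real_scalar_mult_spinor: "of_real c *s (v :: hyp_spinor) = c *\<^sub>R v"
  by (simp add: vec_eq_iff of_real_def)


section \<open>Generalized Tribonacci numbers and spinors\<close>

fun gen_trib :: "int \<Rightarrow> int \<Rightarrow> int \<Rightarrow> real \<Rightarrow> real \<Rightarrow> real \<Rightarrow> nat \<Rightarrow> real" where
  "gen_trib a b c r s t 0 = of_int a"
| "gen_trib a b c r s t (Suc 0) = of_int b"
| "gen_trib a b c r s t (Suc (Suc 0)) = of_int c"
| "gen_trib a b c r s t (Suc (Suc (Suc n))) =
     r * gen_trib a b c r s t (Suc (Suc n)) + s * gen_trib a b c r s t (Suc n)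
       + t * gen_trib a b c r s t n"

definition gen_trib_spinor ::
    "int \<Rightarrow> int \<Rightarrow> int \<Rightarrow> real \<Rightarrow> real \<Rightarrow> real \<Rightarrow> nat \<Rightarrow> hyp_spinor" where
  "gen_trib_spinor a b c r s t n =
     (let V = gen_trib a b c r s t
      in vector [Hyp (V n) (V (n + 3)), Hyp (- V (n + 1)) (V (n + 2))])"

end

theory Submission
  imports Defs
begin

text \<open>
  The spinors inherit the scalar recurrence coordinatewise, so the three formulas are facts about
  any solution \<open>\<phi>\<close> of \<open>\<phi>\<^sub>n\<^sub>+\<^sub>3 = r \<phi>\<^sub>n\<^sub>+\<^sub>2 + s \<phi>\<^sub>n\<^sub>+\<^sub>1 + t \<phi>\<^sub>n\<close> in a real vector space.
  Let \<open>E\<close> be the shift of sequences and \<open>p(x) = x^3 - r x^2 - s x - t\<close>, so that \<open>p(E) \<phi> = 0\<close>.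

  For the full sum, \<open>p(x) - p(1) = (x - 1) q(x)\<close> with \<open>q(x) = x^2 + (1 - r) x + (1 - r - s)\<close>.
  Hence \<open>(r + s + t - 1) \<phi> = - p(1) \<phi> = (E - 1) q(E) \<phi>\<close>, and the sum telescopes
  (\<open>sum_third_order_recurrence\<close>).

  For the even-indexed sum, the step is \<open>E^2 - 1\<close>. The product \<open>p(x) p(-x)\<close> is a polynomial in
  \<open>x^2\<close>, so its difference to \<open>D = p(1) p(-1) = (r + s + t - 1) (r - s + t + 1)\<close> is divisible by
  \<open>x^2 - 1\<close>. Hence \<open>D\<close> is a multiple of \<open>x^2 - 1\<close> modulo \<open>p(x)\<close>; explicitly
  \<open>D x^2 = (x^2 - 1) f(x)\<close> modulo \<open>p(x)\<close>, with \<open>f(x) = (1 - s) x^2 + (t + r s) x + (t^2 + r t)\<close>,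
  and the sum telescopes again (\<open>sum_even_third_order_recurrence\<close>). The odd-indexed sum is the
  even-indexed sum of the shifted solution \<open>E \<phi>\<close> (\<open>sum_odd_third_order_recurrence\<close>).
\<close>

lemma gen_trib_spinor_recurrence:
  "gen_trib_spinor a b c r s t (n + 3) =
     r *\<^sub>R gen_trib_spinor a b c r s t (n + 2) + s *\<^sub>R gen_trib_spinor a b c r s t (n + 1)
       + t *\<^sub>R gen_trib_spinor a b c r s t n"
proof -
  have V: "gen_trib a b c r s t (k + 3) =
      r * gen_trib a b c r s t (k + 2) + s * gen_trib a b c r s t (k + 1)
        + t * gen_trib a b c r s t k" for k
    by (simp add: eval_nat_numeral)
  show ?thesis
    using V[of n] V[of "n + 1"] V[of "n + 2"] V[of "n + 3"]
    by (simp add: gen_trib_spinor_def Let_def vec_eq_iff forall_2 hyp_eq_iff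
        plus_hyp_def scaleR_hyp_def algebra_simps)
qed

text \<open>These split the coefficient \<open>2\<close> that ring normalisation creates by merging equal monomials, so
  that scalar multiples of the same vector cancel.\<close>

lemma scaleR_double:
  fixes v :: "'a :: real_vector"
  shows "(u * 2) *\<^sub>R v = u *\<^sub>R v + u *\<^sub>R v"
    and "(u * (w * 2)) *\<^sub>R v = (u * w) *\<^sub>R v + (u * w) *\<^sub>R v"
  by (simp_all flip: scaleR_add_left)

text \<open>The right-hand side is \<open>q(E) \<phi>\<close> at the index \<open>m + 1\<close> minus \<open>q(E) \<phi>\<close> at the index \<open>0\<close>. The
  denominator stands as a factor on the left, so that the identity also covers the case where it
  vanishes.\<close>

lemma sum_third_order_recurrence:
  fixes \<phi> :: "nat \<Rightarrow> 'a :: real_vector"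
  assumes rec: "\<And>n. \<phi> (n + 3) = r *\<^sub>R \<phi> (n + 2) + s *\<^sub>R \<phi> (n + 1) + t *\<^sub>R \<phi> n"
  shows "(r + s + t - 1) *\<^sub>R (\<Sum>n=0..m. \<phi> n) =
           \<phi> (m + 3) + (1 - r) *\<^sub>R \<phi> (m + 2) + (1 - r - s) *\<^sub>R \<phi> (m + 1)
             - \<phi> 2 + (r - 1) *\<^sub>R \<phi> 1 + (r + s - 1) *\<^sub>R \<phi> 0"
proof (induction m)
  case 0
  show ?case
    using rec[of 0] by (simp add: algebra_simps numeral_2_eq_2)
next
  case (Suc m)
  have x4: "\<phi> (m + 4) = r *\<^sub>R \<phi> (m + 3) + s *\<^sub>R \<phi> (m + 2) + t *\<^sub>R \<phi> (m + 1)"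
    using rec[of "m + 1"] by (simp add: numeral_eq_Suc)
  \<comment> \<open>This is \<open>(x - 1) q(x) = - p(1)\<close> modulo \<open>p(x)\<close>, read at the index \<open>m + 1\<close>.\<close>
  have tele: "\<phi> (m + 4) + (1 - r) *\<^sub>R \<phi> (m + 3) + (1 - r - s) *\<^sub>R \<phi> (m + 2)
      = \<phi> (m + 3) + (1 - r) *\<^sub>R \<phi> (m + 2) + (1 - r - s) *\<^sub>R \<phi> (m + 1)
        + (r + s + t - 1) *\<^sub>R \<phi> (m + 1)"
    unfolding x4 by (simp add: algebra_simps)
  have idx: "Suc m + 3 = m + 4" "Suc m + 2 = m + 3" "Suc m + 1 = m + 2"
    by simp_all
  show ?case
    unfolding sum.atLeast0_atMost_Suc scaleR_add_right Suc.IH idx tele by simp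
qed

text \<open>The right-hand side is \<open>f(E) \<phi>\<close> at the index \<open>2 m\<close>, plus the constant \<open>D \<phi>\<^sub>0 - f(E) \<phi>\<^sub>0\<close> that
  makes it correct for the one-term sum.\<close>

lemma sum_even_third_order_recurrence:
  fixes \<phi> :: "nat \<Rightarrow> 'a :: real_vector"
  assumes rec: "\<And>n. \<phi> (n + 3) = r *\<^sub>R \<phi> (n + 2) + s *\<^sub>R \<phi> (n + 1) + t *\<^sub>R \<phi> n"
  shows "((r + s + t - 1) * (r - s + t + 1)) *\<^sub>R (\<Sum>n=0..m. \<phi> (2 * n)) =
           (1 - s) *\<^sub>R \<phi> (2 * m + 2) + (t + r * s) *\<^sub>R \<phi> (2 * m + 1)
             + (t\<^sup>2 + r * t) *\<^sub>R \<phi> (2 * m)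
             + (s - 1) *\<^sub>R \<phi> 2 + (- t - r * s) *\<^sub>R \<phi> 1
             + (r\<^sup>2 - s\<^sup>2 + r * t + 2 * s - 1) *\<^sub>R \<phi> 0"
proof (induction m)
  case 0
  have "(r + s + t - 1) * (r - s + t + 1) =
      (t\<^sup>2 + r * t) + (r\<^sup>2 - s\<^sup>2 + r * t + 2 * s - 1)"
    by (simp add: algebra_simps power2_eq_square)
  then have "((r + s + t - 1) * (r - s + t + 1)) *\<^sub>R \<phi> 0 =
      (t\<^sup>2 + r * t) *\<^sub>R \<phi> 0 + (r\<^sup>2 - s\<^sup>2 + r * t + 2 * s - 1) *\<^sub>R \<phi> 0"
    by (simp only: scaleR_add_left)
  then show ?case
    by (simp add: scaleR_diff_left scaleR_add_left numeral_2_eq_2)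
next
  case (Suc m)
  define x where "x = \<phi> (2 * m)"
  define y where "y = \<phi> (2 * m + 1)"
  define z where "z = \<phi> (2 * m + 2)"
  have x3: "\<phi> (2 * m + 3) = r *\<^sub>R z + s *\<^sub>R y + t *\<^sub>R x"
    using rec[of "2 * m"] by (simp add: x_def y_def z_def)
  have x4: "\<phi> (2 * m + 4) = r *\<^sub>R (r *\<^sub>R z + s *\<^sub>R y + t *\<^sub>R x) + s *\<^sub>R z + t *\<^sub>R y"
    using rec[of "2 * m + 1"] x3 by (simp add: y_def z_def numeral_eq_Suc)
  \<comment> \<open>This is \<open>(x^2 - 1) f(x) = D x^2\<close> modulo \<open>p(x)\<close>, read at the index \<open>2 m\<close>.\<close>
  have tele: "(1 - s) *\<^sub>R \<phi> (2 * m + 4) + (t + r * s) *\<^sub>R \<phi> (2 * m + 3) + (t\<^sup>2 + r * t) *\<^sub>R z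
      = (1 - s) *\<^sub>R z + (t + r * s) *\<^sub>R y + (t\<^sup>2 + r * t) *\<^sub>R x
        + ((r + s + t - 1) * (r - s + t + 1)) *\<^sub>R z"
    unfolding x3 x4 by (simp add: algebra_simps power2_eq_square scaleR_double)
  have idx: "2 * Suc m = 2 * m + 2" "2 * m + 2 + 2 = 2 * m + 4" "2 * m + 2 + 1 = 2 * m + 3"
    by simp_all
  show ?case
    unfolding sum.atLeast0_atMost_Suc scaleR_add_right Suc.IH idx
    using tele unfolding x_def y_def z_def by simp
qed

lemma sum_odd_third_order_recurrence:
  fixes \<phi> :: "nat \<Rightarrow> 'a :: real_vector"
  assumes rec: "\<And>n. \<phi> (n + 3) = r *\<^sub>R \<phi> (n + 2) + s *\<^sub>R \<phi> (n + 1) + t *\<^sub>R \<phi> n"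
  shows "((r - s + t + 1) * (r + s + t - 1)) *\<^sub>R (\<Sum>n=0..m. \<phi> (2 * n + 1)) =
           (r + t) *\<^sub>R \<phi> (2 * m + 2) + (s - s\<^sup>2 + t\<^sup>2 + r * t) *\<^sub>R \<phi> (2 * m + 1)
             + (t - s * t) *\<^sub>R \<phi> (2 * m)
             + (- r - t) *\<^sub>R \<phi> 2 + (- 1 + s + r\<^sup>2 + r * t) *\<^sub>R \<phi> 1
             + (- t + s * t) *\<^sub>R \<phi> 0"
proof -
  have shifted: "\<phi> (n + 3 + 1) = r *\<^sub>R \<phi> (n + 2 + 1) + s *\<^sub>R \<phi> (n + 1 + 1) + t *\<^sub>R \<phi> (n + 1)" for n
    using rec[of "n + 1"] by (simp add: ac_simps)
  have idx: "2 * m + 2 + 1 = 2 * m + 3" "2 * m + 1 + 1 = 2 * m + 2"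
      "(2::nat) + 1 = 3" "(1::nat) + 1 = 2" "(0::nat) + 1 = 1"
    by simp_all
  have x3: "\<phi> 3 = r *\<^sub>R \<phi> 2 + s *\<^sub>R \<phi> 1 + t *\<^sub>R \<phi> 0"
    using rec[of 0] by (simp add: numeral_2_eq_2)
  \<comment> \<open>The shift brings in \<open>\<phi>\<close> at the indices \<open>2 m + 3\<close> and \<open>3\<close>; the recurrence removes both.\<close>
  show ?thesis
    unfolding mult.commute[of "r - s + t + 1"]
      sum_even_third_order_recurrence[of "\<lambda>n. \<phi> (n + 1)", OF shifted] idx rec[of "2 * m"] x3
    by (simp add: algebra_simps power2_eq_square scaleR_double)
qed

theorem theorem3p13:
  fixes a b c :: int and r s t :: real and m :: nat
    and \<phi> :: "nat \<Rightarrow> hyp_spinor"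
  defines "\<phi> \<equiv> gen_trib_spinor a b c r s t"
  assumes "m > 0"
  shows "(r + s + t - 1 \<noteq> 0 \<longrightarrow>
           (\<Sum>n=0..m. \<phi> n) =
             (\<phi> (m + 3) + (1 - r) *\<^sub>R \<phi> (m + 2) + (1 - r - s) *\<^sub>R \<phi> (m + 1)
               - \<phi> 2 + (r - 1) *\<^sub>R \<phi> 1 + (r + s - 1) *\<^sub>R \<phi> 0)
             /\<^sub>R (r + s + t - 1))
       \<and> ((r + s + t - 1) * (r - s + t + 1) \<noteq> 0 \<longrightarrow>
           (\<Sum>n=0..m. \<phi> (2 * n)) =
             ((1 - s) *\<^sub>R \<phi> (2 * m + 2) + (t + r * s) *\<^sub>R \<phi> (2 * m + 1)
               + (t\<^sup>2 + r * t) *\<^sub>R \<phi> (2 * m)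
               + (s - 1) *\<^sub>R \<phi> 2 + (- t - r * s) *\<^sub>R \<phi> 1
               + (r\<^sup>2 - s\<^sup>2 + r * t + 2 * s - 1) *\<^sub>R \<phi> 0)
             /\<^sub>R ((r + s + t - 1) * (r - s + t + 1)))
       \<and> ((r - s + t + 1) * (r + s + t - 1) \<noteq> 0 \<longrightarrow>
           (\<Sum>n=0..m. \<phi> (2 * n + 1)) =
             ((r + t) *\<^sub>R \<phi> (2 * m + 2) + (s - s\<^sup>2 + t\<^sup>2 + r * t) *\<^sub>R \<phi> (2 * m + 1)
               + (t - s * t) *\<^sub>R \<phi> (2 * m)
               + (- r - t) *\<^sub>R \<phi> 2 + (- 1 + s + r\<^sup>2 + r * t) *\<^sub>R \<phi> 1
               + (- t + s * t) *\<^sub>R \<phi> 0)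
             /\<^sub>R ((r - s + t + 1) * (r + s + t - 1)))"
proof -
  have rec: "\<phi> (n + 3) = r *\<^sub>R \<phi> (n + 2) + s *\<^sub>R \<phi> (n + 1) + t *\<^sub>R \<phi> n" for n
    unfolding \<phi>_def by (rule gen_trib_spinor_recurrence)
  have divide: "x = y /\<^sub>R d" if "d *\<^sub>R x = y" "d \<noteq> 0" for d :: real and x y :: hyp_spinor
    using that by auto
  show ?thesis
    by (intro conjI impI divide sum_third_order_recurrence sum_even_third_order_recurrence
        sum_odd_third_order_recurrence rec)
qed

end
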